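(* Let $\alpha:I\to S^3\subset\mathbb{R}^4$ be a curve parametrized by arc length, lying on the unit sphere $S^3$ centered at the origin, whose curvatures $k_1,k_2,k_3$ as a curve in $\mathbb{R}^4$ are nowhere zero, whose curvature ratios $k_2/k_1$ and $k_3/k_2$ are constant, and whose intrinsic curvature $\kappa$ as a curve in $S^3$ is nowhere zero. Then $\alpha$ is an intrinsic generalized helix of $S^3$ if and only if all its curvatures $k_1,k_2,k_3$ are constant.
   Context: $I\subset\mathbb{R}$ is an open interval. Curves $\alpha:I\to\mathbb{R}^4$ are of class $C^4$ with $\alpha',\alpha'',\alpha'''$ linearly independent at each point. The Frenet frame in $\mathbb{R}^4$: $\overrightarrow{\mathbf e_1},\overrightarrow{\mathbf e_2},\overrightarrow{\mathbf e_3}$ come from the Gram–Schmidt process applied to $\alpha',\alpha'',\alpha'''$, and $\overrightarrow{\mathbf e_4}$ is the unit vector completing them to a positively oriented orthonormal basis; the curvatures are $k_i=\langle\dot{\overrightarrow{\mathbf e_i}},\overrightarrow{\mathbf e_{i+1}}\rangle/\|\alpha'\|$, $i=1,2,3$. For a unit-speed curve in $S^3$ (with its round metric and Levi-Civita connection $\nabla$), the intrinsic Frenet frame $\{\overrightarrow{\mathbf t},\overrightarrow{\mathbf n},\overrightarrow{\mathbf b}\}$, with $\overrightarrow{\mathbf t}=\alpha'$ and $\overrightarrow{\mathbf b}$ chosen so that $\{\overrightarrow{\mathbf t},\overrightarrow{\mathbf n},\overrightarrow{\mathbf b},\alpha\}$ is a positively oriented orthonormal basis of $\mathbb{R}^4$,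 and the intrinsic curvature $\kappa>0$ and torsion $\tau$ are determined by $$\nabla_{\overrightarrow{\mathbf t}}\overrightarrow{\mathbf t}=\kappa\overrightarrow{\mathbf n},\qquad \nabla_{\overrightarrow{\mathbf t}}\overrightarrow{\mathbf n}=-\kappa\overrightarrow{\mathbf t}+\tau\overrightarrow{\mathbf b},\qquad \nabla_{\overrightarrow{\mathbf t}}\overrightarrow{\mathbf b}=-\tau\overrightarrow{\mathbf n}.$$ Intrinsic generalized helix of $S^3$ (general helix in the sense of M. Barros, where the fixed direction in the Euclidean definition of a generalized helix is replaced by a Killing vector field along the curve): the curve satisfies either $\tau\equiv 0$, or there exist a constant $b\in\mathbb{R}$ and a fixed choice of sign such that $\tau=b\kappa\pm 1$ identically on $I$ (by a theorem of Barros this is equivalent to the Killing-field definition, and it is taken here as the definition). *)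

theory Defs
  imports "HOL-Analysis.Analysis"
begin

section \<open>Curves in Euclidean 4-space\<close>

text \<open>
  A curve on an open interval \<open>I\<close> is a total function on the reals; on an open set the two-sided
  derivative at a point of \<open>I\<close> only depends on the values on \<open>I\<close>.
\<close>

definition velocity :: "(real \<Rightarrow> 'a::real_normed_vector) \<Rightarrow> real \<Rightarrow> 'a" where
  "velocity f = (\<lambda>s. vector_derivative f (at s))"

definition C_k_curve_on :: "nat \<Rightarrow> (real \<Rightarrow> 'a::real_normed_vector) \<Rightarrow> real set \<Rightarrow> bool" where
  "C_k_curve_on k f I \<longleftrightarrow>
     (\<forall>j<k. \<forall>s\<in>I. (velocity ^^ j) f differentiable (at s)) \<and>
     continuous_on I ((velocity ^^ k) f)"

text \<open>
  Without \<open>distinct\<close>, repeated vectors would collapse in the set and could count as independent.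
\<close>

definition admissible_curve :: "real set \<Rightarrow> (real \<Rightarrow> real^4) \<Rightarrow> bool" where
  "admissible_curve I \<alpha> \<longleftrightarrow>
     C_k_curve_on 4 \<alpha> I \<and>
     (\<forall>s\<in>I. distinct [velocity \<alpha> s, (velocity ^^ 2) \<alpha> s, (velocity ^^ 3) \<alpha> s] \<and>
            independent {velocity \<alpha> s, (velocity ^^ 2) \<alpha> s, (velocity ^^ 3) \<alpha> s})"

text \<open>The rows of the matrix \<open>vector [u, v, w, x]\<close> are \<open>u, v, w, x\<close>, in this order.\<close>

definition positive_orthonormal_basis :: "real^4 \<Rightarrow> real^4 \<Rightarrow> real^4 \<Rightarrow> real^4 \<Rightarrow> bool" where
  "positive_orthonormal_basis u v w x \<longleftrightarrow>
     norm u = 1 \<and> norm v = 1 \<and> norm w = 1 \<and> norm x = 1 \<and>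
     u \<bullet> v = 0 \<and> u \<bullet> w = 0 \<and> u \<bullet> x = 0 \<and> v \<bullet> w = 0 \<and> v \<bullet> x = 0 \<and> w \<bullet> x = 0 \<and>
     det (vector [u, v, w, x] :: real^4^4) > 0"


section \<open>Frenet frame and curvatures in Euclidean 4-space\<close>

text \<open>Recall that \<open>sgn v\<close> is the normalized vector of \<open>v\<close>.\<close>

definition frenet_e1 :: "(real \<Rightarrow> real^4) \<Rightarrow> real \<Rightarrow> real^4" where
  "frenet_e1 \<alpha> s = sgn (velocity \<alpha> s)"

definition frenet_e2 :: "(real \<Rightarrow> real^4) \<Rightarrow> real \<Rightarrow> real^4" where
  "frenet_e2 \<alpha> s =
     (let v = (velocity ^^ 2) \<alpha> s
      in sgn (v - (v \<bullet> frenet_e1 \<alpha> s) *\<^sub>R frenet_e1 \<alpha> s))"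

definition frenet_e3 :: "(real \<Rightarrow> real^4) \<Rightarrow> real \<Rightarrow> real^4" where
  "frenet_e3 \<alpha> s =
     (let v = (velocity ^^ 3) \<alpha> s
      in sgn (v - (v \<bullet> frenet_e1 \<alpha> s) *\<^sub>R frenet_e1 \<alpha> s
                - (v \<bullet> frenet_e2 \<alpha> s) *\<^sub>R frenet_e2 \<alpha> s))"

definition frenet_e4 :: "(real \<Rightarrow> real^4) \<Rightarrow> real \<Rightarrow> real^4" where
  "frenet_e4 \<alpha> s =
     (THE x. positive_orthonormal_basis (frenet_e1 \<alpha> s) (frenet_e2 \<alpha> s) (frenet_e3 \<alpha> s) x)"

definition curvature1 :: "(real \<Rightarrow> real^4) \<Rightarrow> real \<Rightarrow> real" where
  "curvature1 \<alpha> s = (velocity (frenet_e1 \<alpha>) s \<bullet> frenet_e2 \<alpha> s) / norm (velocity \<alpha> s)"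

definition curvature2 :: "(real \<Rightarrow> real^4) \<Rightarrow> real \<Rightarrow> real" where
  "curvature2 \<alpha> s = (velocity (frenet_e2 \<alpha>) s \<bullet> frenet_e3 \<alpha> s) / norm (velocity \<alpha> s)"

definition curvature3 :: "(real \<Rightarrow> real^4) \<Rightarrow> real \<Rightarrow> real" where
  "curvature3 \<alpha> s = (velocity (frenet_e3 \<alpha>) s \<bullet> frenet_e4 \<alpha> s) / norm (velocity \<alpha> s)"


section \<open>Unit-speed curves in the unit sphere\<close>

text \<open>
  The Levi-Civita covariant derivative, along a curve \<open>\<alpha>\<close> in the round unit sphere, of a vector
  field \<open>X\<close> along \<open>\<alpha>\<close>: the orthogonal projection of \<open>X'\<close> onto the tangent space of the sphere
  at \<open>\<alpha> s\<close>, which is the orthogonal complement of \<open>\<alpha> s\<close>.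
\<close>

definition sphere_cov_deriv :: "(real \<Rightarrow> real^4) \<Rightarrow> (real \<Rightarrow> real^4) \<Rightarrow> real \<Rightarrow> real^4" where
  "sphere_cov_deriv \<alpha> X s = velocity X s - (velocity X s \<bullet> \<alpha> s) *\<^sub>R \<alpha> s"

definition intrinsic_tangent :: "(real \<Rightarrow> real^4) \<Rightarrow> real \<Rightarrow> real^4" where
  "intrinsic_tangent \<alpha> = velocity \<alpha>"

definition intrinsic_curvature :: "(real \<Rightarrow> real^4) \<Rightarrow> real \<Rightarrow> real" where
  "intrinsic_curvature \<alpha> s = norm (sphere_cov_deriv \<alpha> (intrinsic_tangent \<alpha>) s)"

definition intrinsic_normal :: "(real \<Rightarrow> real^4) \<Rightarrow> real \<Rightarrow> real^4" where
  "intrinsic_normal \<alpha> s = sgn (sphere_cov_deriv \<alpha> (intrinsic_tangent \<alpha>) s)"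

definition intrinsic_binormal :: "(real \<Rightarrow> real^4) \<Rightarrow> real \<Rightarrow> real^4" where
  "intrinsic_binormal \<alpha> s =
     (THE b. positive_orthonormal_basis (intrinsic_tangent \<alpha> s) (intrinsic_normal \<alpha> s) b (\<alpha> s))"

definition intrinsic_torsion :: "(real \<Rightarrow> real^4) \<Rightarrow> real \<Rightarrow> real" where
  "intrinsic_torsion \<alpha> s =
     sphere_cov_deriv \<alpha> (intrinsic_normal \<alpha>) s \<bullet> intrinsic_binormal \<alpha> s"

definition intrinsic_generalized_helix :: "real set \<Rightarrow> (real \<Rightarrow> real^4) \<Rightarrow> bool" where
  "intrinsic_generalized_helix I \<alpha> \<longleftrightarrow>
     (\<forall>s\<in>I. intrinsic_torsion \<alpha> s = 0) \<or>
     (\<exists>b. \<exists>\<sigma>\<in>{1, -1}. \<forall>s\<in>I. intrinsic_torsion \<alpha> s = b * intrinsic_curvature \<alpha> s + \<sigma>)"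


section \<open>The frames are well defined\<close>

lemma vector_rows_4:
  "(vector [u, v, w, x] :: 'a::zero^4) $ 1 = u" "(vector [u, v, w, x] :: 'a^4) $ 2 = v"
  "(vector [u, v, w, x] :: 'a^4) $ 3 = w" "(vector [u, v, w, x] :: 'a^4) $ 4 = x"
  by (simp_all add: vector_def)

lemma det_row_product_diagonal:
  fixes A B :: "real^4^4"
  assumes "\<And>i j. i \<noteq> j \<Longrightarrow> A $ i \<bullet> B $ j = 0"
  shows "det A * det B = (A $ 1 \<bullet> B $ 1) * (A $ 2 \<bullet> B $ 2) * (A $ 3 \<bullet> B $ 3) * (A $ 4 \<bullet> B $ 4)"
proof -
  have nth: "(A ** transpose B) $ i $ j = A $ i \<bullet> B $ j" for i j
    by (simp add: matrix_matrix_mult_def transpose_def inner_vec_def)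
  have "det A * det B = det (A ** transpose B)"
    by (simp add: det_mul)
  also have "\<dots> = prod (\<lambda>i. (A ** transpose B) $ i $ i) UNIV"
    by (rule det_diagonal) (use assms in \<open>simp add: nth\<close>)
  also have "\<dots> = (\<Prod>i\<in>{1, 2, 3, 4}. A $ i \<bullet> B $ i)"
    by (simp only: nth UNIV_4)
  also have "\<dots> = (A $ 1 \<bullet> B $ 1) * (A $ 2 \<bullet> B $ 2) * (A $ 3 \<bullet> B $ 3) * (A $ 4 \<bullet> B $ 4)"
    by (simp add: mult.assoc)
  finally show ?thesis .
qed

lemma unit_completion_ex1:
  fixes u v w :: "real^4" and d :: "real^4 \<Rightarrow> real"
  assumes dd: "\<And>x y. \<lbrakk>u \<bullet> x = 0; v \<bullet> x = 0; w \<bullet> x = 0; u \<bullet> y = 0; v \<bullet> y = 0; w \<bullet> y = 0\<rbrakk>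
      \<Longrightarrow> d x * d y = x \<bullet> y"
  shows "\<exists>!x. norm x = 1 \<and> u \<bullet> x = 0 \<and> v \<bullet> x = 0 \<and> w \<bullet> x = 0 \<and> d x > 0"
proof -
  have "card {u, v, w} \<le> 3" by (simp add: card_insert_if)
  then have "dim {u, v, w} < DIM(real^4)"
    using dim_le_card'[of "{u, v, w}"] by simp
  then obtain z where z: "z \<noteq> 0" "\<And>y. y \<in> span {u, v, w} \<Longrightarrow> orthogonal z y"
    using orthogonal_to_subspace_exists by blast
  then have zo: "u \<bullet> z = 0" "v \<bullet> z = 0" "w \<bullet> z = 0"
    by (simp_all add: orthogonal_def span_base inner_commute)
  define x where "x = sgn z"
  have x: "norm x = 1" "u \<bullet> x = 0" "v \<bullet> x = 0" "w \<bullet> x = 0"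
    using z(1) zo by (simp_all add: x_def norm_sgn sgn_div_norm)
  have 1: "d x * d x = 1" "d x * d (- x) = - 1"
    using dd[of x x] dd[of x "- x"] x by (simp_all add: norm_eq_1)
  have "d x > 0 \<or> d (- x) > 0"
  proof (cases "d x > 0")
    case False
    with 1(1) have "d x < 0" by (cases "d x = 0") auto
    moreover have "d x * d (- x) < 0" using 1(2) by simp
    ultimately show ?thesis by (simp add: mult_less_0_iff)
  qed simp
  then have "\<exists>y. norm y = 1 \<and> u \<bullet> y = 0 \<and> v \<bullet> y = 0 \<and> w \<bullet> y = 0 \<and> d y > 0"
  proof
    assume "d x > 0" then show ?thesis using x by blast
  next
    assume "d (- x) > 0" then show ?thesis using x by (intro exI[of _ "- x"]) simp
  qed
  moreover have "y = z"
    if y: "norm y = 1 \<and> u \<bullet> y = 0 \<and> v \<bullet> y = 0 \<and> w \<bullet> y = 0 \<and> d y > 0"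
      and z: "norm z = 1 \<and> u \<bullet> z = 0 \<and> v \<bullet> z = 0 \<and> w \<bullet> z = 0 \<and> d z > 0" for y z
  proof -
    have yz: "d y * d y = 1" "d z * d z = 1" "d y * d z = y \<bullet> z"
      using dd[of y y] dd[of z z] dd[of y z] y z by (simp_all add: norm_eq_1)
    have "d y = 1" "d z = 1"
      using yz(1,2) y z by (auto simp: square_eq_1_iff)
    then have "y \<bullet> z = 1" using yz(3) by simp
    then show "y = z"
      using y z unfolding vector_eq[of y z] norm_eq_1 by simp
  qed
  ultimately show ?thesis by blast
qed

lemma positive_orthonormal_basis_ex1_4:
  fixes u v w :: "real^4"
  assumes "norm u = 1" "norm v = 1" "norm w = 1"
    and "u \<bullet> v = 0" "u \<bullet> w = 0" "v \<bullet> w = 0"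
  shows "\<exists>!x. positive_orthonormal_basis u v w x"
proof -
  let ?d = "\<lambda>x. det (vector [u, v, w, x] :: real^4^4)"
  have "?d x * ?d y = x \<bullet> y"
    if "u \<bullet> x = 0" "v \<bullet> x = 0" "w \<bullet> x = 0" "u \<bullet> y = 0" "v \<bullet> y = 0" "w \<bullet> y = 0" for x y
  proof -
    have *: "\<forall>i j. i \<noteq> j \<longrightarrow>
        (vector [u, v, w, x] :: real^4^4) $ i \<bullet> (vector [u, v, w, y] :: real^4^4) $ j = 0"
      unfolding forall_4 using assms that by (simp add: vector_rows_4 inner_commute)
    show ?thesis
      using assms
      by (subst det_row_product_diagonal) (simp_all add: * vector_rows_4 norm_eq_1)
  qed
  moreover have "positive_orthonormal_basis u v w x \<longleftrightarrow>
      norm x = 1 \<and> u \<bullet> x = 0 \<and> v \<bullet> x = 0 \<and> w \<bullet> x = 0 \<and> ?d x > 0" for x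
    using assms unfolding positive_orthonormal_basis_def by blast
  ultimately show ?thesis
    using unit_completion_ex1[of u v w ?d] by simp
qed

lemma positive_orthonormal_basis_ex1_3:
  fixes u v x :: "real^4"
  assumes "norm u = 1" "norm v = 1" "norm x = 1"
    and "u \<bullet> v = 0" "u \<bullet> x = 0" "v \<bullet> x = 0"
  shows "\<exists>!w. positive_orthonormal_basis u v w x"
proof -
  let ?d = "\<lambda>w. det (vector [u, v, w, x] :: real^4^4)"
  have "?d w * ?d y = w \<bullet> y"
    if "u \<bullet> w = 0" "v \<bullet> w = 0" "x \<bullet> w = 0" "u \<bullet> y = 0" "v \<bullet> y = 0" "x \<bullet> y = 0" for w y
  proof -
    have *: "\<forall>i j. i \<noteq> j \<longrightarrow>
        (vector [u, v, w, x] :: real^4^4) $ i \<bullet> (vector [u, v, y, x] :: real^4^4) $ j = 0"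
      unfolding forall_4 using assms that by (simp add: vector_rows_4 inner_commute)
    show ?thesis
      using assms
      by (subst det_row_product_diagonal) (simp_all add: * vector_rows_4 norm_eq_1)
  qed
  moreover have "positive_orthonormal_basis u v w x \<longleftrightarrow>
      norm w = 1 \<and> u \<bullet> w = 0 \<and> v \<bullet> w = 0 \<and> x \<bullet> w = 0 \<and> ?d w > 0" for w
    using assms unfolding positive_orthonormal_basis_def inner_commute[of x w] by blast
  ultimately show ?thesis
    using unit_completion_ex1[of u v x ?d] by simp
qed

text \<open>
  The Frenet equations with positive curvature determine the frame, the curvature and the torsion,
  and these are the ones defined above.
\<close>

lemma intrinsic_frenet_determined:
  fixes \<alpha> n b :: "real \<Rightarrow> real^4" and \<kappa> \<tau> :: "real \<Rightarrow> real"
  assumes I: "open I" "s \<in> I"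
    and basis: "\<And>r. r \<in> I \<Longrightarrow> positive_orthonormal_basis (velocity \<alpha> r) (n r) (b r) (\<alpha> r)"
    and pos: "\<And>r. r \<in> I \<Longrightarrow> \<kappa> r > 0"
    and frenet_t: "\<And>r. r \<in> I \<Longrightarrow> sphere_cov_deriv \<alpha> (velocity \<alpha>) r = \<kappa> r *\<^sub>R n r"
    and frenet_n: "\<And>r. r \<in> I \<Longrightarrow> sphere_cov_deriv \<alpha> n r = - \<kappa> r *\<^sub>R velocity \<alpha> r + \<tau> r *\<^sub>R b r"
  shows "\<kappa> s = intrinsic_curvature \<alpha> s" "n s = intrinsic_normal \<alpha> s"
    "b s = intrinsic_binormal \<alpha> s" "\<tau> s = intrinsic_torsion \<alpha> s"
proof -
  have n_eq: "n r = intrinsic_normal \<alpha> r" if "r \<in> I" for r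
    using that frenet_t[OF that] pos[OF that] basis[OF that]
    by (simp add: intrinsic_normal_def intrinsic_tangent_def positive_orthonormal_basis_def
        sgn_div_norm)
  show "n s = intrinsic_normal \<alpha> s" using n_eq I(2) .
  show "\<kappa> s = intrinsic_curvature \<alpha> s"
    using frenet_t[OF I(2)] pos[OF I(2)] basis[OF I(2)]
    by (simp add: intrinsic_curvature_def intrinsic_tangent_def positive_orthonormal_basis_def)
  have "\<exists>!w. positive_orthonormal_basis (velocity \<alpha> s) (n s) w (\<alpha> s)"
    using basis[OF I(2)]
    by (intro positive_orthonormal_basis_ex1_3) (auto simp: positive_orthonormal_basis_def)
  from the1_equality[OF this basis[OF I(2)]] show b_eq: "b s = intrinsic_binormal \<alpha> s"
    using n_eq[OF I(2)] by (simp add: intrinsic_binormal_def intrinsic_tangent_def)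
  have "eventually (\<lambda>r. n r = intrinsic_normal \<alpha> r) (nhds s)"
    using n_eq I by (auto simp: eventually_nhds)
  then have "velocity n s = velocity (intrinsic_normal \<alpha>) s"
    unfolding velocity_def by (intro vector_derivative_cong_eq) simp_all
  then have "intrinsic_torsion \<alpha> s = sphere_cov_deriv \<alpha> n s \<bullet> b s"
    by (simp add: intrinsic_torsion_def sphere_cov_deriv_def b_eq)
  also have "\<dots> = \<tau> s"
    unfolding frenet_n[OF I(2)] using basis[OF I(2)]
    by (simp add: positive_orthonormal_basis_def inner_diff_left norm_eq_1)
  finally show "\<tau> s = intrinsic_torsion \<alpha> s" by simp
qed

end

theory Submission
  imports Defs
begin

text \<open>
  Write \<open>k\<^sub>2 = a k\<^sub>1\<close> and \<open>k\<^sub>3 = c k\<^sub>2\<close>. On the sphere \<open>\<alpha> \<bullet> e\<^sub>2 = - 1/k\<^sub>1\<close>, and the Frenet equations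
  give \<open>(\<alpha> \<bullet> e\<^sub>2)' = k\<^sub>2 (\<alpha> \<bullet> e\<^sub>3)\<close> and \<open>(\<alpha> \<bullet> e\<^sub>4)' = - k\<^sub>3 (\<alpha> \<bullet> e\<^sub>3)\<close>, so that \<open>\<alpha> \<bullet> e\<^sub>4 - c/k\<^sub>1\<close> is a
  constant \<open>E\<close>. Evaluating \<open>det (\<alpha>', \<alpha>'', \<alpha>''', \<alpha>)\<close> in both frames yields
  \<open>\<kappa>\<^sup>2 \<tau> = k\<^sub>1\<^sup>2 k\<^sub>2 (\<alpha> \<bullet> e\<^sub>4)\<close>, where \<open>\<kappa>\<^sup>2 = k\<^sub>1\<^sup>2 - 1\<close>; hence
  \<open>(k\<^sub>1\<^sup>2 - 1) \<tau> = a k\<^sub>1\<^sup>2 (E k\<^sub>1 + c)\<close>. If \<open>\<tau> = 0\<close> or \<open>\<tau> = B \<kappa> \<plusminus> 1\<close>, then \<open>k\<^sub>1\<close> is a root of a fixed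
  nonzero polynomial, and a continuous function with finitely many values on an interval is
  constant. Conversely, if \<open>k\<^sub>1\<close> is constant, so are \<open>\<kappa>\<close> and \<open>\<tau>\<close>.
\<close>

section \<open>Determinants in dimension 4\<close>

definition det4 :: "real^4 \<Rightarrow> real^4 \<Rightarrow> real^4 \<Rightarrow> real^4 \<Rightarrow> real" where
  "det4 u v w x = det (vector [u, v, w, x] :: real^4^4)"

text \<open>The Leibniz formula, obtained by peeling one index at a time off the permutations. It
  reduces multilinearity, alternation and differentiability of \<open>det4\<close> to polynomials in
  the coordinates.\<close>

lemma det_4:
  fixes A :: "'a::comm_ring_1^4^4"
  shows "det A =
    A$1$1 * A$2$2 * A$3$3 * A$4$4 - A$1$1 * A$2$2 * A$3$4 * A$4$3 -
    A$1$1 * A$2$3 * A$3$2 * A$4$4 + A$1$1 * A$2$3 * A$3$4 * A$4$2 +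
    A$1$1 * A$2$4 * A$3$2 * A$4$3 - A$1$1 * A$2$4 * A$3$3 * A$4$2 -
    A$1$2 * A$2$1 * A$3$3 * A$4$4 + A$1$2 * A$2$1 * A$3$4 * A$4$3 +
    A$1$2 * A$2$3 * A$3$1 * A$4$4 - A$1$2 * A$2$3 * A$3$4 * A$4$1 -
    A$1$2 * A$2$4 * A$3$1 * A$4$3 + A$1$2 * A$2$4 * A$3$3 * A$4$1 +
    A$1$3 * A$2$1 * A$3$2 * A$4$4 - A$1$3 * A$2$1 * A$3$4 * A$4$2 -
    A$1$3 * A$2$2 * A$3$1 * A$4$4 + A$1$3 * A$2$2 * A$3$4 * A$4$1 +
    A$1$3 * A$2$4 * A$3$1 * A$4$2 - A$1$3 * A$2$4 * A$3$2 * A$4$1 -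
    A$1$4 * A$2$1 * A$3$2 * A$4$3 + A$1$4 * A$2$1 * A$3$3 * A$4$2 +
    A$1$4 * A$2$2 * A$3$1 * A$4$3 - A$1$4 * A$2$2 * A$3$3 * A$4$1 -
    A$1$4 * A$2$3 * A$3$1 * A$4$2 + A$1$4 * A$2$3 * A$3$2 * A$4$1"
proof -
  have f1234: "finite {2::4, 3, 4}" "1 \<notin> {2::4, 3, 4}" by auto
  have f234: "finite {3::4, 4}" "2 \<notin> {3::4, 4}" by auto
  have f34: "finite {4::4}" "3 \<notin> {4::4}" by auto
  show ?thesis
    unfolding det_def UNIV_4
    unfolding sum_over_permutations_insert[OF f1234]
    unfolding sum_over_permutations_insert[OF f234]
    unfolding sum_over_permutations_insert[OF f34]
    unfolding permutes_sing
    by (simp add: sign_swap_id permutation_swap_id sign_compose sign_id permutation_compose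
        algebra_simps)
qed

lemmas det4_expand = det4_def det_4 vector_rows_4

lemma det4_linear:
  "det4 u (a + b) w x = det4 u a w x + det4 u b w x"
  "det4 u (c *\<^sub>R v) w x = c * det4 u v w x"
  "det4 u v (a + b) x = det4 u v a x + det4 u v b x"
  "det4 u v (c *\<^sub>R w) x = c * det4 u v w x"
  "det4 u v w (a + b) = det4 u v w a + det4 u v w b"
  "det4 u v w (c *\<^sub>R x) = c * det4 u v w x"
  by (simp_all add: det4_expand algebra_simps)

lemma det4_alternating:
  "det4 u v u x = 0" "det4 u v v x = 0" "det4 u x w x = 0"
  "det4 u v w u = 0" "det4 u v w v = 0" "det4 u v w w = 0"
  by (simp_all add: det4_expand algebra_simps)

lemma det4_swap_34: "det4 u v x w = - det4 u v w x"
  by (simp add: det4_expand algebra_simps)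

text \<open>The matrix with rows \<open>u, v, w, a\<close> times the transpose of the one with rows
  \<open>u, v, w, b\<close> is diagonal with entries \<open>1, 1, 1, a \<bullet> b\<close>.\<close>

lemma det4_product_orthogonal:
  assumes "norm u = 1" "norm v = 1" "norm w = 1" "u \<bullet> v = 0" "u \<bullet> w = 0" "v \<bullet> w = 0"
    and "u \<bullet> a = 0" "v \<bullet> a = 0" "w \<bullet> a = 0" "u \<bullet> b = 0" "v \<bullet> b = 0" "w \<bullet> b = 0"
  shows "det4 u v w a * det4 u v w b = a \<bullet> b"
proof -
  have *: "\<forall>i j. i \<noteq> j \<longrightarrow>
      (vector [u, v, w, a] :: real^4^4) $ i \<bullet> (vector [u, v, w, b] :: real^4^4) $ j = 0"
    unfolding forall_4 using assms by (simp add: vector_rows_4 inner_commute)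
  show ?thesis
    using assms unfolding det4_def
    by (subst det_row_product_diagonal) (simp_all add: * vector_rows_4 norm_eq_1)
qed

text \<open>Thus \<open>x\<close> is the triple cross product of \<open>u, v, w\<close>. Removing
  from \<open>y\<close> its components along these three changes neither side; the rest follows from
  the product formula, as \<open>det4 u v w x = 1\<close>.\<close>

lemma positive_orthonormal_basis_det4:
  assumes "positive_orthonormal_basis u v w x"
  shows "det4 u v w y = x \<bullet> y"
proof -
  have on: "norm u = 1" "norm v = 1" "norm w = 1" "norm x = 1"
    "u \<bullet> v = 0" "u \<bullet> w = 0" "u \<bullet> x = 0" "v \<bullet> w = 0" "v \<bullet> x = 0" "w \<bullet> x = 0"
    and pos: "det4 u v w x > 0"
    using assms by (auto simp: positive_orthonormal_basis_def det4_def)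
  have "det4 u v w x * det4 u v w x = 1"
    using det4_product_orthogonal[of u v w x x] on by (simp add: norm_eq_1)
  with pos have one: "det4 u v w x = 1" by (auto simp: square_eq_1_iff)
  define z where "z = y - (u \<bullet> y) *\<^sub>R u - (v \<bullet> y) *\<^sub>R v - (w \<bullet> y) *\<^sub>R w"
  have y: "y = z + ((u \<bullet> y) *\<^sub>R u + ((v \<bullet> y) *\<^sub>R v + (w \<bullet> y) *\<^sub>R w))"
    by (simp add: z_def)
  have z: "u \<bullet> z = 0" "v \<bullet> z = 0" "w \<bullet> z = 0" "x \<bullet> z = x \<bullet> y"
    using on by (simp_all add: z_def inner_diff_right norm_eq_1 inner_commute)
  have "det4 u v w y = det4 u v w z"
    by (subst y) (simp add: det4_linear det4_alternating)
  also have "\<dots> = x \<bullet> y"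
    using det4_product_orthogonal[of u v w x z] on z one by simp
  finally show ?thesis .
qed

text \<open>Exchanging the last two vectors reverses the orientation and negating one restores it,
  so the formula for the fourth vector applies to \<open>u, v, - x, w\<close>.\<close>

lemma positive_orthonormal_basis_det4_3:
  assumes "positive_orthonormal_basis u v w x"
  shows "det4 u v y x = w \<bullet> y"
proof -
  have neg: "det4 u v (- x) a = - det4 u v x a" for a
    using det4_linear(4)[of u v "-1" x a] by simp
  have "positive_orthonormal_basis u v (- x) w"
    using assms neg[of w] det4_swap_34[of u v x w]
    by (auto simp: positive_orthonormal_basis_def det4_def inner_commute)
  from positive_orthonormal_basis_det4[OF this, of y] show ?thesis
    using neg[of y] det4_swap_34[of u v x y] by simp
qed

text \<open>The remainder \<open>z\<close> is orthogonal to all four vectors; its squared norm is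
  the square of \<open>det4 u v w z\<close>, which equals \<open>x \<bullet> z = 0\<close>.\<close>

lemma positive_orthonormal_basis_expansion:
  assumes "positive_orthonormal_basis u v w x"
  shows "y = (u \<bullet> y) *\<^sub>R u + (v \<bullet> y) *\<^sub>R v + (w \<bullet> y) *\<^sub>R w + (x \<bullet> y) *\<^sub>R x"
proof -
  define z where "z = y - (u \<bullet> y) *\<^sub>R u - (v \<bullet> y) *\<^sub>R v - (w \<bullet> y) *\<^sub>R w - (x \<bullet> y) *\<^sub>R x"
  have on: "norm u = 1" "norm v = 1" "norm w = 1" "norm x = 1"
    "u \<bullet> v = 0" "u \<bullet> w = 0" "u \<bullet> x = 0" "v \<bullet> w = 0" "v \<bullet> x = 0" "w \<bullet> x = 0"
    using assms by (auto simp: positive_orthonormal_basis_def)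
  have z: "u \<bullet> z = 0" "v \<bullet> z = 0" "w \<bullet> z = 0" "x \<bullet> z = 0"
    using on by (simp_all add: z_def inner_diff_right norm_eq_1 inner_commute)
  have "z \<bullet> z = det4 u v w z * det4 u v w z"
    using det4_product_orthogonal[of u v w z z] on z by simp
  also have "\<dots> = 0"
    using positive_orthonormal_basis_det4[OF assms, of z] z by simp
  finally have "z = 0" by simp
  then show ?thesis by (simp add: z_def algebra_simps)
qed


section \<open>Derivatives of vector fields along a curve\<close>

lemma has_vector_derivative_inner:
  fixes f g :: "real \<Rightarrow> 'a::real_inner"
  assumes "(f has_vector_derivative f') (at s)" "(g has_vector_derivative g') (at s)"
  shows "((\<lambda>r. f r \<bullet> g r) has_vector_derivative (f s \<bullet> g' + f' \<bullet> g s)) (at s)"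
  using bounded_bilinear.has_vector_derivative[OF bounded_bilinear_inner assms] .

lemma inner_constant_derivative:
  fixes f g :: "real \<Rightarrow> 'a::real_inner"
  assumes "open I" "s \<in> I" "\<And>r. r \<in> I \<Longrightarrow> f r \<bullet> g r = c"
    and "(f has_vector_derivative f') (at s)" "(g has_vector_derivative g') (at s)"
  shows "f s \<bullet> g' + f' \<bullet> g s = 0"
proof (rule vector_derivative_unique_at)
  show "((\<lambda>r. f r \<bullet> g r) has_vector_derivative (f s \<bullet> g' + f' \<bullet> g s)) (at s)"
    by (rule has_vector_derivative_inner) fact+
  show "((\<lambda>r. f r \<bullet> g r) has_vector_derivative 0) (at s)"
    by (rule has_vector_derivative_transform_within_open[OF _ assms(1,2), of "\<lambda>_. c"])
      (simp_all add: assms(3))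
qed

text \<open>Differentiating the factor \<open>1 / norm f\<close> only adds a multiple of
  \<open>f s\<close>. Its coefficient stays unspecified because the formula is later paired with
  vectors orthogonal to \<open>f s\<close>.\<close>

lemma has_vector_derivative_sgn:
  fixes f :: "real \<Rightarrow> 'a::real_inner"
  assumes f: "(f has_vector_derivative f') (at s)" and nz: "f s \<noteq> 0"
  obtains c where
    "((\<lambda>r. sgn (f r)) has_vector_derivative (c *\<^sub>R f s + inverse (norm (f s)) *\<^sub>R f')) (at s)"
proof -
  have "f differentiable (at s)"
    using f by (rule differentiableI_vector)
  then have "(\<lambda>r. norm (f r)) differentiable (at s)"
    using differentiable_chain_at[of f s norm] nz by (simp add: comp_def)
  then have "(\<lambda>r. inverse (norm (f r))) differentiable (at s)"
    using nz by (intro differentiable_inverse) auto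
  then obtain c where c: "((\<lambda>r. inverse (norm (f r))) has_field_derivative c) (at s)"
    by (auto simp: real_differentiable_def)
  have "((\<lambda>r. inverse (norm (f r)) *\<^sub>R f r) has_vector_derivative
      (inverse (norm (f s)) *\<^sub>R f' + c *\<^sub>R f s)) (at s)"
    by (rule has_vector_derivative_scaleR[OF c f])
  with that[of c] show ?thesis by (simp add: sgn_div_norm add.commute)
qed

lemma differentiable_vec_nth:
  fixes f :: "real \<Rightarrow> real^4"
  assumes "f differentiable (at s)"
  shows "(\<lambda>r. f r $ i) differentiable (at s)"
  using assms bounded_linear.has_derivative[OF bounded_linear_vec_nth]
  unfolding differentiable_def by blast

lemma differentiable_det4:
  fixes u v w x :: "real \<Rightarrow> real^4"
  assumes "u differentiable (at s)" "v differentiable (at s)"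
    "w differentiable (at s)" "x differentiable (at s)"
  shows "(\<lambda>r. det4 (u r) (v r) (w r) (x r)) differentiable (at s)"
  unfolding det4_expand
  by (intro differentiable_add differentiable_diff differentiable_mult differentiable_vec_nth
      assms)


section \<open>The Frenet frame of a unit-speed curve in the sphere\<close>

text \<open>Each nonvanishing assumption keeps a vector that gets normalized from being zero:
  \<open>A\<close> for \<open>k1\<close>, the Gram-Schmidt remainder of \<open>J\<close> for
  \<open>k2\<close>, and \<open>A + \<alpha>\<close> for \<kappa>.\<close>

locale spherical_frenet_curve =
  fixes I :: "real set" and \<alpha> :: "real \<Rightarrow> real^4"
  assumes open_I: "open I"
    and smooth: "C_k_curve_on 4 \<alpha> I"
    and norm_curve: "s \<in> I \<Longrightarrow> norm (\<alpha> s) = 1"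
    and norm_velocity: "s \<in> I \<Longrightarrow> norm (velocity \<alpha> s) = 1"
    and curvature1_nz: "s \<in> I \<Longrightarrow> curvature1 \<alpha> s \<noteq> 0"
    and curvature2_nz: "s \<in> I \<Longrightarrow> curvature2 \<alpha> s \<noteq> 0"
    and intrinsic_curvature_nz: "s \<in> I \<Longrightarrow> intrinsic_curvature \<alpha> s \<noteq> 0"
begin

abbreviation "T \<equiv> velocity \<alpha>"
abbreviation "A \<equiv> (velocity ^^ 2) \<alpha>"
abbreviation "J \<equiv> (velocity ^^ 3) \<alpha>"
abbreviation "e1 \<equiv> frenet_e1 \<alpha>"
abbreviation "e2 \<equiv> frenet_e2 \<alpha>"
abbreviation "e3 \<equiv> frenet_e3 \<alpha>"
abbreviation "e4 \<equiv> frenet_e4 \<alpha>"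
abbreviation "k1 \<equiv> curvature1 \<alpha>"
abbreviation "k2 \<equiv> curvature2 \<alpha>"
abbreviation "k3 \<equiv> curvature3 \<alpha>"
abbreviation "\<kappa> \<equiv> intrinsic_curvature \<alpha>"
abbreviation "\<tau> \<equiv> intrinsic_torsion \<alpha>"

section \<open>Velocities up to third order and the first two frame vectors\<close>

lemma velocity_iterate:
  assumes "s \<in> I"
  shows "(\<alpha> has_vector_derivative T s) (at s)" "(T has_vector_derivative A s) (at s)"
    "(A has_vector_derivative J s) (at s)" "J differentiable (at s)"
proof -
  have diff: "(velocity ^^ j) \<alpha> differentiable (at s)" if "j < 4" for j
    using smooth that assms by (auto simp: C_k_curve_on_def)
  have step: "((velocity ^^ j) \<alpha> has_vector_derivative (velocity ^^ Suc j) \<alpha> s) (at s)"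
    if "j < 4" for j
    using diff[OF that] by (simp add: velocity_def vector_derivative_works)
  show "(\<alpha> has_vector_derivative T s) (at s)" "(T has_vector_derivative A s) (at s)"
    "(A has_vector_derivative J s) (at s)"
    using step[of 0] step[of 1] step[of 2] by (simp_all add: numeral_2_eq_2 numeral_3_eq_3)
  show "J differentiable (at s)" using diff[of 3] by simp
qed

text \<open>Differentiate the unit norms of \<open>\<alpha>\<close> and \<open>T\<close>, and then
  the relation \<open>\<alpha> \<bullet> T = 0\<close>.\<close>

lemma inner_velocities:
  assumes "s \<in> I"
  shows "\<alpha> s \<bullet> \<alpha> s = 1" "T s \<bullet> T s = 1" "\<alpha> s \<bullet> T s = 0" "T s \<bullet> A s = 0" "\<alpha> s \<bullet> A s = - 1"
proof -
  have *: "\<alpha> r \<bullet> \<alpha> r = 1" "T r \<bullet> T r = 1" if "r \<in> I" for r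
    using norm_curve[OF that] norm_velocity[OF that] by (simp_all add: norm_eq_1)
  show "\<alpha> s \<bullet> \<alpha> s = 1" "T s \<bullet> T s = 1" using *[OF assms] .
  have **: "\<alpha> r \<bullet> T r = 0" if "r \<in> I" for r
    using inner_constant_derivative[OF open_I that *(1) velocity_iterate(1)[OF that]
        velocity_iterate(1)[OF that]] by (simp add: inner_commute)
  show "\<alpha> s \<bullet> T s = 0" using **[OF assms] .
  show "T s \<bullet> A s = 0"
    using inner_constant_derivative[OF open_I assms *(2) velocity_iterate(2)[OF assms]
        velocity_iterate(2)[OF assms]] by (simp add: inner_commute)
  show "\<alpha> s \<bullet> A s = - 1"
    using inner_constant_derivative[OF open_I assms ** velocity_iterate(1)[OF assms]
        velocity_iterate(2)[OF assms]] *(2)[OF assms] by simp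
qed

lemma frenet_e1_eq: "s \<in> I \<Longrightarrow> e1 s = T s"
  using norm_velocity[of s] by (simp add: frenet_e1_def sgn_div_norm)

lemma frenet_e1_derivative: "s \<in> I \<Longrightarrow> (e1 has_vector_derivative A s) (at s)"
  by (rule has_vector_derivative_transform_within_open[OF velocity_iterate(2) open_I])
    (simp_all add: frenet_e1_eq)

text \<open>Unit speed makes \<open>A\<close> orthogonal to \<open>T\<close>, so Gram-Schmidt
  subtracts nothing.\<close>

lemma frenet_e2_eq: "s \<in> I \<Longrightarrow> e2 s = sgn (A s)"
  using inner_velocities(4)[of s] by (simp add: frenet_e2_def frenet_e1_eq inner_commute)

lemma curvature1_eq:
  assumes "s \<in> I"
  shows "k1 s = norm (A s)"
proof -
  have "velocity e1 s = A s"
    using frenet_e1_derivative[OF assms] by (simp add: velocity_def vector_derivative_at)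
  then have "k1 s = A s \<bullet> sgn (A s)"
    using assms by (simp add: curvature1_def frenet_e2_eq norm_velocity)
  \<comment> \<open>The case \<open>A s = 0\<close>, with \<open>sgn 0 = 0\<close>, has to be
    covered: it is excluded only afterwards, by this formula and
    \<open>k1 s \<noteq> 0\<close>.\<close>
  also have "\<dots> = norm (A s)"
    by (cases "A s = 0")
      (simp_all add: sgn_div_norm power2_norm_eq_inner[symmetric] power2_eq_square)
  finally show ?thesis .
qed

lemma acceleration_nz: "s \<in> I \<Longrightarrow> A s \<noteq> 0"
  using curvature1_eq curvature1_nz by fastforce

lemma curvature1_pos: "s \<in> I \<Longrightarrow> k1 s > 0"
  using curvature1_eq acceleration_nz by simp

lemma acceleration_eq: "s \<in> I \<Longrightarrow> A s = k1 s *\<^sub>R e2 s"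
  using acceleration_nz by (simp add: curvature1_eq frenet_e2_eq sgn_div_norm)

lemma frenet_e2_derivative_ex:
  assumes "s \<in> I"
  obtains c where "(e2 has_vector_derivative (c *\<^sub>R A s + inverse (k1 s) *\<^sub>R J s)) (at s)"
proof -
  obtain c where "((\<lambda>r. sgn (A r)) has_vector_derivative
      (c *\<^sub>R A s + inverse (norm (A s)) *\<^sub>R J s)) (at s)"
    using has_vector_derivative_sgn[OF velocity_iterate(3)[OF assms] acceleration_nz[OF assms]] .
  then have "(e2 has_vector_derivative (c *\<^sub>R A s + inverse (norm (A s)) *\<^sub>R J s)) (at s)"
    by (rule has_vector_derivative_transform_within_open[OF _ open_I assms])
      (simp add: frenet_e2_eq)
  with that show thesis by (simp add: curvature1_eq assms)
qed

section \<open>The third Gram-Schmidt step and the complete Frenet basis\<close>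

definition "jerk_rejection s = J s - (J s \<bullet> e1 s) *\<^sub>R e1 s - (J s \<bullet> e2 s) *\<^sub>R e2 s"

lemma frenet_e3_eq: "e3 s = sgn (jerk_rejection s)"
  by (simp add: frenet_e3_def jerk_rejection_def Let_def)

lemma frenet_12_orthonormal:
  assumes "s \<in> I"
  shows "norm (e1 s) = 1" "norm (e2 s) = 1" "e1 s \<bullet> e2 s = 0" "e1 s \<bullet> e3 s = 0" "e2 s \<bullet> e3 s = 0"
proof -
  show 1: "norm (e1 s) = 1" "norm (e2 s) = 1" "e1 s \<bullet> e2 s = 0"
    using assms acceleration_nz[OF assms] inner_velocities(4)[OF assms]
    by (simp_all add: frenet_e1_eq frenet_e2_eq norm_velocity norm_sgn)
      (simp add: sgn_div_norm)
  show "e1 s \<bullet> e3 s = 0" "e2 s \<bullet> e3 s = 0"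
    using 1 by (simp_all add: frenet_e3_eq sgn_div_norm jerk_rejection_def inner_diff_right norm_eq_1
        inner_commute)
qed

text \<open>Pairing the derivative of \<open>e2\<close> with \<open>e3\<close> removes the
  unspecified multiple of \<open>A\<close>, which is parallel to \<open>e2\<close>. At this stage
  \<open>e3\<close> is only known to be orthogonal to \<open>e1\<close> and
  \<open>e2\<close>.\<close>

lemma jerk_inner_e3:
  assumes "s \<in> I"
  shows "J s \<bullet> e3 s = k1 s * k2 s"
proof -
  obtain c where "(e2 has_vector_derivative (c *\<^sub>R A s + inverse (k1 s) *\<^sub>R J s)) (at s)"
    using frenet_e2_derivative_ex[OF assms] .
  then have "velocity e2 s = c *\<^sub>R A s + inverse (k1 s) *\<^sub>R J s"
    by (simp add: velocity_def vector_derivative_at)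
  then have "k2 s = inverse (k1 s) * (J s \<bullet> e3 s)"
    using assms acceleration_eq[OF assms] frenet_12_orthonormal[OF assms]
    by (simp add: curvature2_def norm_velocity inner_add_left)
  then show ?thesis using curvature1_pos[OF assms] by (simp add: field_simps)
qed

text \<open>A vanishing remainder would give \<open>e3 s = sgn 0 = 0\<close>, hence
  \<open>k1 s * k2 s = 0\<close>.\<close>

lemma jerk_rejection_nz: "s \<in> I \<Longrightarrow> jerk_rejection s \<noteq> 0"
  using jerk_inner_e3[of s] curvature1_nz[of s] curvature2_nz[of s]
  by (auto simp: frenet_e3_eq)

lemma frenet_basis:
  assumes "s \<in> I"
  shows "positive_orthonormal_basis (e1 s) (e2 s) (e3 s) (e4 s)"
  unfolding frenet_e4_def
  by (rule theI', rule positive_orthonormal_basis_ex1_4)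
    (use frenet_12_orthonormal[OF assms] jerk_rejection_nz[OF assms]
      in \<open>simp_all add: frenet_e3_eq norm_sgn\<close>)

lemma frenet_orthonormal:
  assumes "s \<in> I"
  shows "e1 s \<bullet> e1 s = 1" "e2 s \<bullet> e2 s = 1" "e3 s \<bullet> e3 s = 1" "e4 s \<bullet> e4 s = 1"
    "e1 s \<bullet> e2 s = 0" "e1 s \<bullet> e3 s = 0" "e1 s \<bullet> e4 s = 0"
    "e2 s \<bullet> e3 s = 0" "e2 s \<bullet> e4 s = 0" "e3 s \<bullet> e4 s = 0"
  using frenet_basis[OF assms] by (simp_all add: positive_orthonormal_basis_def norm_eq_1)

text \<open>Pairing the Gram-Schmidt decomposition with \<open>e3\<close> identifies the norm of the
  remainder as \<open>k1 s * k2 s\<close>.\<close>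

lemma jerk_eq:
  assumes "s \<in> I"
  shows "J s = (J s \<bullet> e1 s) *\<^sub>R e1 s + (J s \<bullet> e2 s) *\<^sub>R e2 s + (k1 s * k2 s) *\<^sub>R e3 s"
proof -
  have J: "J s = (J s \<bullet> e1 s) *\<^sub>R e1 s + (J s \<bullet> e2 s) *\<^sub>R e2 s + norm (jerk_rejection s) *\<^sub>R e3 s"
    using jerk_rejection_nz[OF assms] by (simp add: frenet_e3_eq sgn_div_norm jerk_rejection_def)
  have "J s \<bullet> e3 s = norm (jerk_rejection s)"
    by (subst J) (simp add: inner_add_left frenet_orthonormal[OF assms])
  then have *: "norm (jerk_rejection s) = k1 s * k2 s"
    using jerk_inner_e3[OF assms] by simp
  show ?thesis using J unfolding * .
qed

lemma jerk_inner_e4: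
  assumes "s \<in> I"
  shows "J s \<bullet> e4 s = 0"
  by (subst jerk_eq[OF assms]) (simp add: inner_add_left frenet_orthonormal[OF assms])

lemma frenet_differentiable:
  assumes "s \<in> I"
  shows "e1 differentiable (at s)" "e2 differentiable (at s)" "e3 differentiable (at s)"
    "e4 differentiable (at s)"
proof -
  have d1: "e1 differentiable (at r)" if "r \<in> I" for r
    using frenet_e1_derivative[OF that] by (rule differentiableI_vector)
  have d2: "e2 differentiable (at r)" if "r \<in> I" for r
    by (rule frenet_e2_derivative_ex[OF that], rule differentiableI_vector)
  have d3: "e3 differentiable (at r)" if "r \<in> I" for r
  proof -
    \<comment> \<open>Differentiability of \<open>J\<close>, the fourth order of smoothness, enters
      here.\<close>
    have "(\<lambda>s. J s - (J s \<bullet> e1 s) *\<^sub>R e1 s - (J s \<bullet> e2 s) *\<^sub>R e2 s) differentiable (at r)"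
      by (intro differentiable_diff differentiable_scaleR differentiable_inner
          velocity_iterate(4) d1 d2 that)
    then have "jerk_rejection differentiable (at r)" by (simp add: jerk_rejection_def[abs_def])
    then have "(jerk_rejection has_vector_derivative velocity jerk_rejection r) (at r)"
      by (simp add: velocity_def vector_derivative_works)
    then obtain v where "((\<lambda>r. sgn (jerk_rejection r)) has_vector_derivative v) (at r)"
      using has_vector_derivative_sgn[of jerk_rejection "velocity jerk_rejection r" r]
        jerk_rejection_nz[OF \<open>r \<in> I\<close>] by blast
    then have "(\<lambda>r. sgn (jerk_rejection r)) differentiable (at r)"
      by (rule differentiableI_vector)
    then show ?thesis by (simp add: frenet_e3_eq[abs_def])
  qed
  show "e1 differentiable (at s)" "e2 differentiable (at s)" "e3 differentiable (at s)"
    using d1 d2 d3 assms by auto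
  \<comment> \<open>Although \<open>e4\<close> is given by a definite description, its pairing with
    a fixed \<open>b\<close> is the determinant of \<open>e1, e2, e3, b\<close>, which is
    differentiable.\<close>
  have "(\<lambda>r. e4 r \<bullet> b) differentiable (at s)" for b
  proof -
    have "(\<lambda>r. det4 (e1 r) (e2 r) (e3 r) b) differentiable (at s)"
      by (intro differentiable_det4 d1 d2 d3 assms) simp
    then have "((\<lambda>r. det4 (e1 r) (e2 r) (e3 r) b) has_vector_derivative
        vector_derivative (\<lambda>r. det4 (e1 r) (e2 r) (e3 r) b) (at s)) (at s)"
      by (simp add: vector_derivative_works)
    then have "((\<lambda>r. e4 r \<bullet> b) has_vector_derivative
        vector_derivative (\<lambda>r. det4 (e1 r) (e2 r) (e3 r) b) (at s)) (at s)"
      by (rule has_vector_derivative_transform_within_open[OF _ open_I assms])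
        (simp add: positive_orthonormal_basis_det4[OF frenet_basis])
    then show ?thesis by (rule differentiableI_vector)
  qed
  then show "e4 differentiable (at s)"
    by (subst differentiable_componentwise_within) blast
qed

section \<open>The Frenet equations for \<open>e2\<close> and \<open>e4\<close>\<close>

lemma frenet_has_velocity:
  assumes "s \<in> I"
  shows "(e2 has_vector_derivative velocity e2 s) (at s)"
    "(e3 has_vector_derivative velocity e3 s) (at s)"
    "(e4 has_vector_derivative velocity e4 s) (at s)"
  using frenet_differentiable[OF assms] by (simp_all add: velocity_def vector_derivative_works)

text \<open>The coefficients along \<open>e1\<close> and \<open>e2\<close> come from differentiated
  orthonormality, the one along \<open>e3\<close> is the definition of \<open>k2\<close>, and the
  one along \<open>e4\<close> vanishes because \<open>A\<close> and \<open>J\<close> are orthogonal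
  to \<open>e4\<close>.\<close>

lemma frenet_e2_velocity:
  assumes "s \<in> I"
  shows "velocity e2 s = - k1 s *\<^sub>R e1 s + k2 s *\<^sub>R e3 s"
proof -
  note on = frenet_orthonormal
  obtain c where "(e2 has_vector_derivative (c *\<^sub>R A s + inverse (k1 s) *\<^sub>R J s)) (at s)"
    using frenet_e2_derivative_ex[OF assms] .
  then have v: "velocity e2 s = c *\<^sub>R A s + inverse (k1 s) *\<^sub>R J s"
    by (simp add: velocity_def vector_derivative_at)
  have "e1 s \<bullet> velocity e2 s = - k1 s"
    using inner_constant_derivative[OF open_I assms on(5) frenet_e1_derivative[OF assms]
        frenet_has_velocity(1)[OF assms]] on[OF assms] acceleration_eq[OF assms] by simp
  moreover have "e2 s \<bullet> velocity e2 s = 0"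
    using inner_constant_derivative[OF open_I assms on(2) frenet_has_velocity(1)[OF assms]
        frenet_has_velocity(1)[OF assms]] by (simp add: inner_commute)
  moreover have "e3 s \<bullet> velocity e2 s = k2 s"
    using assms by (simp add: curvature2_def norm_velocity inner_commute)
  moreover have "e4 s \<bullet> velocity e2 s = 0"
    using on[OF assms] jerk_inner_e4[OF assms] acceleration_eq[OF assms]
    by (simp add: v inner_add_right inner_commute)
  ultimately show ?thesis
    using positive_orthonormal_basis_expansion[OF frenet_basis[OF assms], of "velocity e2 s"]
    by simp
qed

text \<open>All coefficients come from differentiating the orthonormality relations of
  \<open>e4\<close>; the derivative of \<open>e3\<close> enters only through its pairing with
  \<open>e4\<close>, which is \<open>k3\<close>.\<close>

lemma frenet_e4_velocity:
  assumes "s \<in> I"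
  shows "velocity e4 s = - k3 s *\<^sub>R e3 s"
proof -
  note on = frenet_orthonormal
  note const = inner_constant_derivative[OF open_I assms _ _ frenet_has_velocity(3)[OF assms]]
  have "e1 s \<bullet> velocity e4 s = 0"
    using const[OF on(7) frenet_e1_derivative[OF assms]] on[OF assms] acceleration_eq[OF assms]
    by simp
  moreover have "e2 s \<bullet> velocity e4 s = 0"
    using const[OF on(9) frenet_has_velocity(1)[OF assms]] on[OF assms]
      frenet_e2_velocity[OF assms] by (simp add: inner_diff_left)
  moreover have "e3 s \<bullet> velocity e4 s = - k3 s"
    using const[OF on(10) frenet_has_velocity(2)[OF assms]] assms
    by (simp add: curvature3_def norm_velocity)
  moreover have "e4 s \<bullet> velocity e4 s = 0"
    using const[OF on(4) frenet_has_velocity(3)[OF assms]] by (simp add: inner_commute)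
  ultimately show ?thesis
    using positive_orthonormal_basis_expansion[OF frenet_basis[OF assms], of "velocity e4 s"]
    by simp
qed

section \<open>Components of the curve in its Frenet frame\<close>

lemma curve_inner_e2: "s \<in> I \<Longrightarrow> \<alpha> s \<bullet> e2 s = - inverse (k1 s)"
  using inner_velocities(5)[of s] acceleration_eq[of s] curvature1_pos[of s]
  by (simp add: field_simps)

lemma curve_inner_e2_derivative:
  assumes "s \<in> I"
  shows "((\<lambda>r. \<alpha> r \<bullet> e2 r) has_vector_derivative k2 s * (\<alpha> s \<bullet> e3 s)) (at s)"
  using has_vector_derivative_inner[OF velocity_iterate(1) frenet_has_velocity(1), OF assms assms]
    frenet_orthonormal(5)[OF assms] inner_velocities(3)[OF assms]
  by (simp add: frenet_e2_velocity frenet_e1_eq assms inner_diff_right inner_add_right)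

lemma curve_inner_e4_derivative:
  assumes "s \<in> I"
  shows "((\<lambda>r. \<alpha> r \<bullet> e4 r) has_vector_derivative - k3 s * (\<alpha> s \<bullet> e3 s)) (at s)"
  using has_vector_derivative_inner[OF velocity_iterate(1) frenet_has_velocity(3), OF assms assms]
    frenet_orthonormal(7)[OF assms]
  by (simp add: frenet_e4_velocity frenet_e1_eq assms)


section \<open>The intrinsic torsion in terms of the Euclidean curvatures\<close>

text \<open>Since \<open>\<alpha> \<bullet> A = - 1\<close>, projecting \<open>A\<close> onto the
  tangent space adds \<open>\<alpha>\<close>.\<close>

lemma sphere_cov_deriv_tangent: "s \<in> I \<Longrightarrow> sphere_cov_deriv \<alpha> T s = A s + \<alpha> s"
  using inner_velocities(5)[of s]
  by (simp add: sphere_cov_deriv_def numeral_2_eq_2 inner_commute)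

lemma intrinsic_curvature_eq: "s \<in> I \<Longrightarrow> \<kappa> s = norm (A s + \<alpha> s)"
  by (simp add: intrinsic_curvature_def intrinsic_tangent_def sphere_cov_deriv_tangent)

lemma intrinsic_curvature_pos: "s \<in> I \<Longrightarrow> \<kappa> s > 0"
  using intrinsic_curvature_nz by (simp add: intrinsic_curvature_def)

lemma intrinsic_curvature_square: "s \<in> I \<Longrightarrow> (\<kappa> s)\<^sup>2 = (k1 s)\<^sup>2 - 1"
  using inner_velocities[of s]
  by (simp add: intrinsic_curvature_eq curvature1_eq power2_norm_eq_inner inner_add_left
      inner_add_right inner_commute)

lemma intrinsic_normal_eq: "s \<in> I \<Longrightarrow> intrinsic_normal \<alpha> s = sgn (A s + \<alpha> s)"
  by (simp add: intrinsic_normal_def intrinsic_tangent_def sphere_cov_deriv_tangent)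

lemma intrinsic_basis:
  assumes "s \<in> I"
  shows "positive_orthonormal_basis (T s) (intrinsic_normal \<alpha> s) (intrinsic_binormal \<alpha> s) (\<alpha> s)"
proof -
  have nz: "A s + \<alpha> s \<noteq> 0"
    using intrinsic_curvature_pos[OF assms] intrinsic_curvature_eq[OF assms] by auto
  show ?thesis
    unfolding intrinsic_binormal_def intrinsic_tangent_def
    by (rule theI', rule positive_orthonormal_basis_ex1_3)
      (use nz assms inner_velocities[OF assms] in \<open>simp_all add: norm_curve norm_velocity
        intrinsic_normal_eq norm_sgn sgn_div_norm inner_add_left inner_add_right inner_commute\<close>)
qed

text \<open>Both sides equal the determinant of \<open>T, A, J, \<alpha>\<close>. On the intrinsic
  side one factor \<kappa> comes from differentiating the normalized \<open>?n\<close>, the other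
  from replacing \<open>?n\<close> by \<open>A + \<alpha>\<close>; on the Frenet side only the
  \<open>e3\<close> component of \<open>J\<close> survives.\<close>

lemma intrinsic_torsion_eq:
  assumes "s \<in> I"
  shows "(\<kappa> s)\<^sup>2 * \<tau> s = (k1 s)\<^sup>2 * k2 s * (\<alpha> s \<bullet> e4 s)"
proof -
  let ?n = "intrinsic_normal \<alpha>" and ?b = "intrinsic_binormal \<alpha> s" and ?P = "\<lambda>r. A r + \<alpha> r"
  note basis = intrinsic_basis[OF assms]
  have P: "?P s = \<kappa> s *\<^sub>R ?n s"
    using assms intrinsic_curvature_pos[OF assms]
    by (simp add: intrinsic_curvature_eq intrinsic_normal_eq sgn_div_norm)
  have "(?P has_vector_derivative (J s + T s)) (at s)"
    by (intro has_vector_derivative_add velocity_iterate assms)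
  moreover have "?P s \<noteq> 0"
    using intrinsic_curvature_pos[OF assms] intrinsic_curvature_eq[OF assms] by auto
  ultimately obtain c where "((\<lambda>r. sgn (?P r)) has_vector_derivative
      (c *\<^sub>R ?P s + inverse (norm (?P s)) *\<^sub>R (J s + T s))) (at s)"
    by (rule has_vector_derivative_sgn)
  then have "(?n has_vector_derivative (c *\<^sub>R ?P s + inverse (\<kappa> s) *\<^sub>R (J s + T s))) (at s)"
    unfolding intrinsic_curvature_eq[OF assms]
    by (rule has_vector_derivative_transform_within_open[OF _ open_I assms])
      (simp add: intrinsic_normal_eq)
  then have n': "velocity ?n s = c *\<^sub>R ?P s + inverse (\<kappa> s) *\<^sub>R (J s + T s)"
    by (simp add: velocity_def vector_derivative_at)
  have "\<tau> s = velocity ?n s \<bullet> ?b"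
    using basis by (simp add: intrinsic_torsion_def sphere_cov_deriv_def inner_diff_left
        inner_diff_right positive_orthonormal_basis_def inner_commute)
  \<comment> \<open>The terms along \<open>?P s\<close> and \<open>T s\<close> are orthogonal to
    \<open>?b\<close>.\<close>
  also have "\<dots> = inverse (\<kappa> s) * (J s \<bullet> ?b)"
    using basis unfolding n' P
    by (simp add: inner_add_left positive_orthonormal_basis_def)
  finally have "\<kappa> s * \<tau> s = J s \<bullet> ?b"
    using intrinsic_curvature_pos[OF assms] by (simp add: field_simps)
  also have "\<dots> = det4 (T s) (?n s) (J s) (\<alpha> s)"
    using positive_orthonormal_basis_det4_3[OF basis] by (simp add: inner_commute)
  finally have "(\<kappa> s)\<^sup>2 * \<tau> s = det4 (T s) (?P s) (J s) (\<alpha> s)"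
    unfolding P by (simp add: det4_linear power2_eq_square)
  \<comment> \<open>The summand \<open>\<alpha> s\<close> in the second slot repeats the fourth slot
    and drops out.\<close>
  also have "\<dots> = det4 (e1 s) (k1 s *\<^sub>R e2 s) (J s) (\<alpha> s)"
    unfolding acceleration_eq[OF assms, symmetric]
    by (simp add: det4_linear det4_alternating frenet_e1_eq assms)
  also have "\<dots> = k1 s * (k1 s * k2 s) * det4 (e1 s) (e2 s) (e3 s) (\<alpha> s)"
    by (subst jerk_eq[OF assms]) (simp add: det4_linear det4_alternating)
  also have "\<dots> = (k1 s)\<^sup>2 * k2 s * (\<alpha> s \<bullet> e4 s)"
    using positive_orthonormal_basis_det4[OF frenet_basis[OF assms]]
    by (simp add: power2_eq_square inner_commute)
  finally show ?thesis .
qed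

section \<open>Torsion against curvature when the curvature ratios are constant\<close>

lemma continuous_on_curvature1: "continuous_on I k1"
proof -
  have "continuous_on I A"
    using velocity_iterate(3) has_vector_derivative_continuous
    by (meson continuous_at_imp_continuous_on)
  then have "continuous_on I (\<lambda>s. norm (A s))" by (rule continuous_on_norm)
  then show ?thesis by (simp add: curvature1_eq cong: continuous_on_cong)
qed

text \<open>The derivative of \<open>?F\<close> is
  \<open>(c * k2 - k3) * (\<alpha> \<bullet> e3) = 0\<close>, so \<open>?F\<close> is a constant
  \<open>E\<close> on the interval.\<close>

lemma curve_inner_e4_eq:
  assumes "is_interval I" and c: "\<And>s. s \<in> I \<Longrightarrow> k3 s = c * k2 s"
  obtains E where "\<And>s. s \<in> I \<Longrightarrow> \<alpha> s \<bullet> e4 s = E + c * inverse (k1 s)"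
proof -
  let ?F = "\<lambda>s. \<alpha> s \<bullet> e4 s + c * (\<alpha> s \<bullet> e2 s)"
  have "(?F has_vector_derivative 0) (at s within I)" if "s \<in> I" for s
  proof -
    have "(?F has_vector_derivative - k3 s * (\<alpha> s \<bullet> e3 s) + c * (k2 s * (\<alpha> s \<bullet> e3 s))) (at s)"
      by (intro has_vector_derivative_add curve_inner_e4_derivative that
          has_vector_derivative_mult_right curve_inner_e2_derivative)
    then show ?thesis
      using c[OF that] by (auto intro: has_vector_derivative_at_within)
  qed
  then obtain E where "\<And>s. s \<in> I \<Longrightarrow> ?F s = E"
    using has_vector_derivative_zero_constant[of I ?F] assms(1)
    by (auto simp: is_interval_convex_1)
  then show thesis
    by (intro that[of E]) (fastforce simp: curve_inner_e2)
qed

text \<open>The factor \<open>k1\<close> of \<open>k2 = a * k1\<close> clears the reciprocal in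
  \<open>\<alpha> \<bullet> e4\<close>, leaving a polynomial in \<open>k1\<close> on the
  right.\<close>

lemma torsion_curvature_relation:
  assumes "is_interval I"
    and a: "\<And>s. s \<in> I \<Longrightarrow> k2 s = a * k1 s" and c: "\<And>s. s \<in> I \<Longrightarrow> k3 s = c * k2 s"
  obtains E where
    "\<And>s. s \<in> I \<Longrightarrow> ((k1 s)\<^sup>2 - 1) * \<tau> s = a * (k1 s)\<^sup>2 * (E * k1 s + c)"
proof -
  obtain E where E: "\<And>s. s \<in> I \<Longrightarrow> \<alpha> s \<bullet> e4 s = E + c * inverse (k1 s)"
    using curve_inner_e4_eq[OF assms(1) c] by blast
  have "((k1 s)\<^sup>2 - 1) * \<tau> s = a * (k1 s)\<^sup>2 * (E * k1 s + c)" if "s \<in> I" for s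
  proof -
    have "k2 s * (\<alpha> s \<bullet> e4 s) = a * (E * k1 s + c)"
      using curvature1_nz[OF that] by (simp add: a E that field_simps)
    with intrinsic_torsion_eq[OF that] show ?thesis
      by (simp add: intrinsic_curvature_square that mult.assoc mult.left_commute)
  qed
  then show thesis by (rule that)
qed

end


section \<open>Helices with constant curvature ratios\<close>

text \<open>This is the helix condition after squaring has eliminated \<kappa>, a polynomial
  equation of degree at most 6 in \<open>k\<close>.\<close>

lemma finite_helix_curvatures:
  fixes a c E B \<sigma> :: real
  assumes "\<sigma> \<noteq> 0"
  shows "finite {k. (a * k\<^sup>2 * (E * k + c) - \<sigma> * (k\<^sup>2 - 1))\<^sup>2 = B\<^sup>2 * (k\<^sup>2 - 1) ^ 3}"
proof -
  define p where "p = [:\<sigma>, 0, a * c - \<sigma>, a * E:]\<^sup>2 - smult (B\<^sup>2) ([:- 1, 0, 1:] ^ 3)"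
  \<comment> \<open>The leading terms may cancel, but the constant terms cannot.\<close>
  have "poly p 0 = \<sigma>\<^sup>2 + B\<^sup>2" by (simp add: p_def)
  also have "\<dots> \<noteq> 0" using assms by (simp add: sum_power2_eq_zero_iff)
  finally have "p \<noteq> 0" by auto
  then have "finite {k. poly p k = 0}" by (rule poly_roots_finite)
  moreover have "poly p k =
      (a * k\<^sup>2 * (E * k + c) - \<sigma> * (k\<^sup>2 - 1))\<^sup>2 - B\<^sup>2 * (k\<^sup>2 - 1) ^ 3" for k
    by (simp add: p_def algebra_simps power2_eq_square)
  ultimately show ?thesis by simp
qed

theorem proposition1:
  fixes I :: "real set" and \<alpha> :: "real \<Rightarrow> real^4"
  assumes "open I" and "is_interval I" and "I \<noteq> {}"
    and "admissible_curve I \<alpha>"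
    and "\<forall>s\<in>I. \<alpha> s \<in> sphere 0 1"
    and "\<forall>s\<in>I. norm (velocity \<alpha> s) = 1"
    and "\<forall>s\<in>I. curvature1 \<alpha> s \<noteq> 0 \<and> curvature2 \<alpha> s \<noteq> 0 \<and> curvature3 \<alpha> s \<noteq> 0"
    and "(\<lambda>s. curvature2 \<alpha> s / curvature1 \<alpha> s) constant_on I"
    and "(\<lambda>s. curvature3 \<alpha> s / curvature2 \<alpha> s) constant_on I"
    and "\<forall>s\<in>I. intrinsic_curvature \<alpha> s \<noteq> 0"
  shows "intrinsic_generalized_helix I \<alpha> \<longleftrightarrow>
    curvature1 \<alpha> constant_on I \<and> curvature2 \<alpha> constant_on I \<and> curvature3 \<alpha> constant_on I"
proof -
  interpret spherical_frenet_curve I \<alpha>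
    using assms by unfold_locales (auto simp: admissible_curve_def)
  obtain a c where ac: "\<And>s. s \<in> I \<Longrightarrow> k2 s / k1 s = a" "\<And>s. s \<in> I \<Longrightarrow> k3 s / k2 s = c"
    using assms(8,9) unfolding constant_on_def by blast
  have a: "k2 s = a * k1 s" and c: "k3 s = c * k2 s" if "s \<in> I" for s
    using ac[OF that] curvature1_nz[OF that] curvature2_nz[OF that] by (auto simp: field_simps)
  obtain s\<^sub>0 where s\<^sub>0: "s\<^sub>0 \<in> I" using assms(3) by blast
  have nz: "a \<noteq> 0" "c \<noteq> 0"
    using a[OF s\<^sub>0] c[OF s\<^sub>0] assms(7) s\<^sub>0 by auto
  obtain E where E:
    "\<And>s. s \<in> I \<Longrightarrow> ((k1 s)\<^sup>2 - 1) * \<tau> s = a * (k1 s)\<^sup>2 * (E * k1 s + c)"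
    using torsion_curvature_relation[OF assms(2) a c] by blast
  have "k1 constant_on I" if "intrinsic_generalized_helix I \<alpha>"
  proof -
    \<comment> \<open>A continuous \<open>k1\<close> with finitely many values on a connected set is
      constant, so a finite set of candidates suffices.\<close>
    have "\<exists>S. finite S \<and> k1 ` I \<subseteq> S"
      using that unfolding intrinsic_generalized_helix_def
    proof (elim disjE exE bexE)
      assume 0: "\<forall>s\<in>I. \<tau> s = 0"
      have "k1 s \<in> {- c / E}" if "s \<in> I" for s
      proof -
        have "E * k1 s + c = 0"
          using E[OF that] 0 that nz curvature1_pos[OF that] by simp
        \<comment> \<open>Here \<open>E = 0\<close> would force \<open>c = 0\<close>, so
          \<open>- c / E\<close> is a genuine quotient.\<close>
        with nz show ?thesis by (cases "E = 0") (auto simp: field_simps)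
      qed
      then show ?thesis by (intro exI[of _ "{- c / E}"]) auto
    next
      fix B \<sigma> :: real
      assume \<sigma>: "\<sigma> \<in> {1, - 1}" and B: "\<forall>s\<in>I. \<tau> s = B * \<kappa> s + \<sigma>"
      let ?S = "{k. (a * k\<^sup>2 * (E * k + c) - \<sigma> * (k\<^sup>2 - 1))\<^sup>2 = B\<^sup>2 * (k\<^sup>2 - 1) ^ 3}"
      have "k1 s \<in> ?S" if "s \<in> I" for s
      proof -
        have "a * (k1 s)\<^sup>2 * (E * k1 s + c) - \<sigma> * ((k1 s)\<^sup>2 - 1) = B * \<kappa> s * ((k1 s)\<^sup>2 - 1)"
          using E[OF that] B that by (simp add: algebra_simps)
        \<comment> \<open>Squaring lets \<kappa> occur only through its square, which is a
          polynomial in \<open>k1\<close>.\<close>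
        then have "(a * (k1 s)\<^sup>2 * (E * k1 s + c) - \<sigma> * ((k1 s)\<^sup>2 - 1))\<^sup>2 =
            B\<^sup>2 * (\<kappa> s)\<^sup>2 * ((k1 s)\<^sup>2 - 1)\<^sup>2"
          by (simp add: power_mult_distrib)
        then show ?thesis
          unfolding intrinsic_curvature_square[OF that]
          by (simp add: power2_eq_square power3_eq_cube mult.assoc)
      qed
      moreover have "finite ?S" using \<sigma> by (intro finite_helix_curvatures) auto
      ultimately show ?thesis by (intro exI[of _ ?S]) blast
    qed
    then have "finite (k1 ` I)" by (meson finite_subset)
    with assms(2) show ?thesis
      by (intro continuous_finite_range_constant continuous_on_curvature1)
        (simp add: is_interval_connected)
  qed
  moreover have "k2 constant_on I \<and> k3 constant_on I" if "k1 constant_on I"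
  proof -
    obtain k where "\<And>s. s \<in> I \<Longrightarrow> k1 s = k"
      using \<open>k1 constant_on I\<close> unfolding constant_on_def by blast
    then have "\<And>s. s \<in> I \<Longrightarrow> k2 s = a * k" "\<And>s. s \<in> I \<Longrightarrow> k3 s = c * (a * k)"
      using a c by simp_all
    then show ?thesis unfolding constant_on_def by blast
  qed
  moreover have "intrinsic_generalized_helix I \<alpha>" if const: "k1 constant_on I"
  proof -
    have k: "k1 s = k1 s\<^sub>0" if "s \<in> I" for s
      using const that s\<^sub>0 unfolding constant_on_def by auto
    have \<kappa>: "\<kappa> s = \<kappa> s\<^sub>0" if "s \<in> I" for s
      using intrinsic_curvature_square[OF that] intrinsic_curvature_square[OF s\<^sub>0] k[OF that]
        intrinsic_curvature_pos[OF that] intrinsic_curvature_pos[OF s\<^sub>0]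
      by (intro power2_eq_imp_eq[of "\<kappa> s" "\<kappa> s\<^sub>0"]) simp_all
    \<comment> \<open>With this factor nonzero, the relation \<open>E\<close> can be solved for
      \<tau>.\<close>
    have "(k1 s\<^sub>0)\<^sup>2 - 1 \<noteq> 0"
      using intrinsic_curvature_square[OF s\<^sub>0] intrinsic_curvature_pos[OF s\<^sub>0]
      by auto
    then have \<tau>: "\<tau> s = \<tau> s\<^sub>0" if "s \<in> I" for s
      using E[OF that, unfolded k[OF that], folded E[OF s\<^sub>0]] by simp
    \<comment> \<open>As \<kappa> and \<tau> are constant, the sign can be taken to be
      \<open>1\<close>; the slope is then forced by the values at \<open>s\<^sub>0\<close>.\<close>
    have "\<forall>s\<in>I. \<tau> s = (\<tau> s\<^sub>0 - 1) / \<kappa> s\<^sub>0 * \<kappa> s + 1"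
      using \<kappa> \<tau> intrinsic_curvature_pos[OF s\<^sub>0] by simp
    then show ?thesis unfolding intrinsic_generalized_helix_def by blast
  qed
  ultimately show ?thesis by blast
qed

end
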